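(* Let $\mathbb{F}$ be a field in which every quadratic and every cubic polynomial has a root. Among the algebras of the context (parameters in $\mathbb{F}$), exactly those listed below have left quasiunits, and for each of them the set of all left quasiunits is as indicated. (I) $\mathrm{Char}(\mathbb{F})\neq2,3$: - $A_1(\alpha_1,\alpha_2,\alpha_4,\beta_1)$ with $\beta_1\neq0$, $\alpha_2=-\frac{2\alpha_1(\alpha_1-1)+\beta_1}{2\beta_1}$, $\alpha_4=-\frac{2\alpha_2(\alpha_1-1)}{2\beta_1}$: $\frac{2(\alpha_1-1)}{\beta_1}e_1+2e_2$; - $A_1(1,\alpha_2,\frac{\alpha_2(1+2\alpha_2)}{2},0)$: $-(1+2\alpha_2)e_1+2e_2$; - $A_2(\alpha_1,0,\alpha_1)$, $\alpha_1\neq0$: $\frac1{\alpha_1}e_1$; - $A_4(1,\beta_2)$: $e_1+te_2$, $t\in\mathbb{F}$; - $A_4(\alpha_1,\beta_2)$, $\alpha_1\neq0,1$, $\beta_2\neq2\alpha_1-1$: $\frac1{\alpha_1}e_1$; - $A_4(\alpha_1,2\alpha_1-1)$, $\alpha_1\neq0,1$: $\frac1{\alpha_1}e_1+te_2$, $t\in\mathbb{F}$; - $A_5(1)$: $e_1+te_2$, $t\in\mathbb{F}$; - $A_6(\frac12,0)$: $2e_1$; - $A_8(\alpha_1)$, $\alpha_1\neq0,\frac13$: $\frac1{\alpha_1}e_1$; - $A_8(\frac13)$: $3e_1+te_2$, $t\in\mathbb{F}$; - $A_{10}$: $-e_2$. (II) $\mathrm{Char}(\mathbb{F})=2$: - $A_{1,2}(\alpha_1,0,\alpha_4,0)$,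 $\alpha_1\neq0$: $-\frac1{\alpha_1}e_1$; - $A_{2,2}(\alpha_1,0,\beta_2)$, $\alpha_1\neq0$: $\frac1{\alpha_1}e_1$; - $A_{3,2}(1,\beta_2)$: $e_2$; - $A_{3,2}(\alpha_1,1)$: $e_2$; - $A_{4,2}(1,\beta_2)$: $e_1+te_2$, $t\in\mathbb{F}$; - $A_{4,2}(\alpha_1,\beta_2)$, $\alpha_1\neq0,1$, $\beta_2\neq1$: $\frac1{\alpha_1}e_1$; - $A_{4,2}(\alpha_1,1)$, $\alpha_1\neq0,1$: $\frac1{\alpha_1}e_1+te_2$, $t\in\mathbb{F}$; - $A_{5,2}(1)$: $e_1+te_2$, $t\in\mathbb{F}$; - $A_{6,2}(\alpha_1,0)$, $\alpha_1\neq0$: $\frac1{\alpha_1}e_1$; - $A_{7,2}(0)$ and $A_{7,2}(1)$: $e_2$; - $A_{8,2}(\alpha_1)$, $\alpha_1\neq0,1$: $\frac1{\alpha_1}e_1$; - $A_{8,2}(1)$: $e_1+te_2$, $t\in\mathbb{F}$; - $A_{10,2}$: $e_2$. (III) $\mathrm{Char}(\mathbb{F})=3$: - $A_{1,3}\big(\alpha_1,\ \frac{\alpha_1(1-\alpha_1)}{\beta_1}-\frac12,\ \frac{\alpha_1(1-\alpha_1)^2}{\beta_1^2}-\frac{1-\alpha_1}{2\beta_1},\ \beta_1\big)$, $\beta_1\neq0$: $\frac{1-\alpha_1}{\beta_1}e_1+2e_2$; - $A_{1,3}(1,\alpha_2,\frac{\alpha_2(2\alpha_2+1)}{2},0)$: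 $(\alpha_2-1)e_1+2e_2$; - $A_{2,3}(\alpha_1,0,\alpha_1)$, $\alpha_1\neq0$: $\frac1{\alpha_1}e_1$; - $A_{4,3}(\alpha_1,-1-\alpha_1)$, $\alpha_1\neq0,1$: $\frac1{\alpha_1}e_1+te_2$, $t\in\mathbb{F}$; - $A_{4,3}(\alpha_1,\beta_2)$, $\alpha_1\neq0,1$, $\beta_2\neq-1-\alpha_1$: $\frac1{\alpha_1}e_1$; - $A_{4,3}(1,\beta_2)$: $e_1+te_2$, $t\in\mathbb{F}$; - $A_{5,3}(1)$: $e_1+te_2$, $t\in\mathbb{F}$; - $A_{6,3}(-1,0)$: $-e_1$; - $A_{8,3}(\alpha_1)$, $\alpha_1\neq0$: $\frac1{\alpha_1}e_1$; - $A_{10,3}$: $te_1-e_2$, $t\in\mathbb{F}$.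
   Context: An algebra is a vector space with a bilinear product (not necessarily associative, commutative or unital). An element $\mathbf e_q$ of an algebra $\mathbb{A}$ is a left quasiunit if $\mathbf e_q(\mathbf u\mathbf v)=(\mathbf e_q\mathbf u)\mathbf v+\mathbf u(\mathbf e_q\mathbf v)-\mathbf u\mathbf v$ for all $\mathbf u,\mathbf v\in\mathbb{A}$. A two-dimensional algebra with basis $e_1,e_2$ is identified with its matrix of structure constants (MSC) $A=\begin{pmatrix}\alpha_1&\alpha_2&\alpha_3&\alpha_4\\ \beta_1&\beta_2&\beta_3&\beta_4\end{pmatrix}$, meaning $e_1e_1=\alpha_1e_1+\beta_1e_2$, $e_1e_2=\alpha_2e_1+\beta_2e_2$, $e_2e_1=\alpha_3e_1+\beta_3e_2$, $e_2e_2=\alpha_4e_1+\beta_4e_2$. Families for $\mathrm{Char}(\mathbb{F})\ne2,3$: $A_1(\alpha_1,\alpha_2,\alpha_4,\beta_1)=\begin{pmatrix}\alpha_1&\alpha_2&\alpha_2+1&\alpha_4\\ \beta_1&-\alpha_1&-\alpha_1+1&-\alpha_2\end{pmatrix}$, $A_2(\alpha_1,\beta_1,\beta_2)=\begin{pmatrix}\alpha_1&0&0&1\\ \beta_1&\beta_2&1-\alpha_1&0\end{pmatrix}$, $A_3(\beta_1,\beta_2)=\begin{pmatrix}0&1&1&0\\ \beta_1&\beta_2&1&-1\end{pmatrix}$, $A_4(\alpha_1,\beta_2)=\begin{pmatrix}\alpha_1&0&0&0\\ 0&\beta_2&1-\alpha_1&0\end{pmatrix}$, $A_5(\alpha_1)=\begin{pmatrix}\alpha_1&0&0&0\\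 1&2\alpha_1-1&1-\alpha_1&0\end{pmatrix}$, $A_6(\alpha_1,\beta_1)=\begin{pmatrix}\alpha_1&0&0&1\\ \beta_1&1-\alpha_1&-\alpha_1&0\end{pmatrix}$, $A_7(\beta_1)=\begin{pmatrix}0&1&1&0\\ \beta_1&1&0&-1\end{pmatrix}$, $A_8(\alpha_1)=\begin{pmatrix}\alpha_1&0&0&0\\ 0&1-\alpha_1&-\alpha_1&0\end{pmatrix}$, $A_9=\begin{pmatrix}\frac13&0&0&0\\ 1&\frac23&-\frac13&0\end{pmatrix}$, $A_{10}=\begin{pmatrix}0&1&1&0\\ 0&0&0&-1\end{pmatrix}$, $A_{11}=\begin{pmatrix}0&1&1&0\\ 1&0&0&-1\end{pmatrix}$, $A_{12}=\begin{pmatrix}0&0&0&0\\ 1&0&0&0\end{pmatrix}$. Families for $\mathrm{Char}(\mathbb{F})=2$: $A_{1,2}(\alpha_1,\alpha_2,\alpha_4,\beta_1)=\begin{pmatrix}\alpha_1&\alpha_2&\alpha_2+1&\alpha_4\\ \beta_1&-\alpha_1&-\alpha_1+1&-\alpha_2\end{pmatrix}$, $A_{2,2}(\alpha_1,\beta_1,\beta_2)=\begin{pmatrix}\alpha_1&0&0&1\\ \beta_1&\beta_2&1-\alpha_1&0\end{pmatrix}$, $A_{3,2}(\alpha_1,\beta_2)=\begin{pmatrix}\alpha_1&1&1&0\\ 0&\beta_2&1-\alpha_1&1\end{pmatrix}$, $A_{4,2}(\alpha_1,\beta_2)=\begin{pmatrix}\alpha_1&0&0&0\\ 0&\beta_2&1-\alpha_1&0\end{pmatrix}$,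 $A_{5,2}(\alpha_1)=\begin{pmatrix}\alpha_1&0&0&0\\ 1&1&1-\alpha_1&0\end{pmatrix}$, $A_{6,2}(\alpha_1,\beta_1)=\begin{pmatrix}\alpha_1&0&0&1\\ \beta_1&1-\alpha_1&-\alpha_1&0\end{pmatrix}$, $A_{7,2}(\alpha_1)=\begin{pmatrix}\alpha_1&1&1&0\\ 0&1-\alpha_1&-\alpha_1&-1\end{pmatrix}$, $A_{8,2}(\alpha_1)=\begin{pmatrix}\alpha_1&0&0&0\\ 0&1-\alpha_1&-\alpha_1&0\end{pmatrix}$, $A_{9,2}=\begin{pmatrix}1&0&0&0\\ 1&0&1&0\end{pmatrix}$, $A_{10,2}=\begin{pmatrix}0&1&1&0\\ 0&0&0&-1\end{pmatrix}$, $A_{11,2}=\begin{pmatrix}1&1&1&0\\ 0&-1&-1&-1\end{pmatrix}$, $A_{12,2}=\begin{pmatrix}0&0&0&0\\ 1&0&0&0\end{pmatrix}$. Families for $\mathrm{Char}(\mathbb{F})=3$: $A_{1,3}(\alpha_1,\alpha_2,\alpha_4,\beta_1)=\begin{pmatrix}\alpha_1&\alpha_2&\alpha_2+1&\alpha_4\\ \beta_1&-\alpha_1&-\alpha_1+1&-\alpha_2\end{pmatrix}$, $A_{2,3}(\alpha_1,\beta_1,\beta_2)=\begin{pmatrix}\alpha_1&0&0&1\\ \beta_1&\beta_2&1-\alpha_1&0\end{pmatrix}$, $A_{3,3}(\beta_1,\beta_2)=\begin{pmatrix}0&1&1&0\\ \beta_1&\beta_2&1&-1\end{pmatrix}$,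 $A_{4,3}(\alpha_1,\beta_2)=\begin{pmatrix}\alpha_1&0&0&0\\ 0&\beta_2&1-\alpha_1&0\end{pmatrix}$, $A_{5,3}(\alpha_1)=\begin{pmatrix}\alpha_1&0&0&0\\ 1&-1-\alpha_1&1-\alpha_1&0\end{pmatrix}$, $A_{6,3}(\alpha_1,\beta_1)=\begin{pmatrix}\alpha_1&0&0&1\\ \beta_1&1-\alpha_1&-\alpha_1&0\end{pmatrix}$, $A_{7,3}(\beta_1)=\begin{pmatrix}0&1&1&0\\ \beta_1&1&0&-1\end{pmatrix}$, $A_{8,3}(\alpha_1)=\begin{pmatrix}\alpha_1&0&0&0\\ 0&1-\alpha_1&-\alpha_1&0\end{pmatrix}$, $A_{9,3}=\begin{pmatrix}0&1&1&0\\ 1&0&0&-1\end{pmatrix}$, $A_{10,3}=\begin{pmatrix}0&1&1&0\\ 0&0&0&-1\end{pmatrix}$, $A_{11,3}=\begin{pmatrix}1&0&0&0\\ 1&-1&-1&0\end{pmatrix}$, $A_{12,3}=\begin{pmatrix}0&0&0&0\\ 1&0&0&0\end{pmatrix}$. *)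

theory Defs
  imports "HOL-Analysis.Analysis" "HOL-Computational_Algebra.Polynomial"
begin

definition left_quasiunit :: "('v::ab_group_add \<Rightarrow> 'v \<Rightarrow> 'v) \<Rightarrow> 'v \<Rightarrow> bool" where
  "left_quasiunit p e \<longleftrightarrow>
     (\<forall>u v. p e (p u v) = p (p e u) v + p u (p e v) - p u v)"

definition e1 :: "'a::field ^ 2" where "e1 = axis 1 1"

definition e2 :: "'a::field ^ 2" where "e2 = axis 2 1"

text \<open>The product with matrix of structure constants \<open>A\<close> is \<open>A (u \<otimes> v)\<close>, with the Kronecker
  product ordered as \<open>u1 v1, u1 v2, u2 v1, u2 v2\<close>; the first row of \<open>A\<close> gives the \<open>e1\<close>-coordinate
  and the second row the \<open>e2\<close>-coordinate.\<close>

definition msc_mult :: "'a::field ^ 4 ^ 2 \<Rightarrow> 'a ^ 2 \<Rightarrow> 'a ^ 2 \<Rightarrow> 'a ^ 2" where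
  "msc_mult A u v = A *v vector [u $ 1 * v $ 1, u $ 1 * v $ 2, u $ 2 * v $ 1, u $ 2 * v $ 2]"

definition left_quasiunits :: "'a::field ^ 4 ^ 2 \<Rightarrow> ('a ^ 2) set" where
  "left_quasiunits A = {e. left_quasiunit (msc_mult A) e}"

lemma vec_4_nth:
  fixes a b c d :: "'a::zero"
  shows "(vector [a, b, c, d] :: 'a ^ 4) $ 1 = a"
    and "(vector [a, b, c, d] :: 'a ^ 4) $ 2 = b"
    and "(vector [a, b, c, d] :: 'a ^ 4) $ 3 = c"
    and "(vector [a, b, c, d] :: 'a ^ 4) $ 4 = d"
  unfolding vector_def by simp_all

lemma msc_mult_basis:
  fixes A :: "'a::field ^ 4 ^ 2"
  assumes "A = vector [vector [\<alpha>1, \<alpha>2, \<alpha>3, \<alpha>4], vector [\<beta>1, \<beta>2, \<beta>3, \<beta>4]]"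
  shows "msc_mult A e1 e1 = \<alpha>1 *s e1 + \<beta>1 *s e2"
    and "msc_mult A e1 e2 = \<alpha>2 *s e1 + \<beta>2 *s e2"
    and "msc_mult A e2 e1 = \<alpha>3 *s e1 + \<beta>3 *s e2"
    and "msc_mult A e2 e2 = \<alpha>4 *s e1 + \<beta>4 *s e2"
  by (simp_all add: vec_eq_iff forall_2 msc_mult_def assms e1_def e2_def axis_def
      matrix_vector_mult_def sum_4 vec_4_nth)

lemma msc_mult_bilinear:
  fixes A :: "'a::field ^ 4 ^ 2"
  shows "Vector_Spaces.linear (*s) (*s) (msc_mult A u)"
    and "Vector_Spaces.linear (*s) (*s) (\<lambda>u. msc_mult A u v)"
  by (unfold_locales, simp_all add: vec_eq_iff forall_2 msc_mult_def matrix_vector_mult_def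
      sum_4 vec_4_nth algebra_simps)+

text \<open>The families in characteristic different from 2 and 3.\<close>

definition A1 :: "'a::field \<Rightarrow> 'a \<Rightarrow> 'a \<Rightarrow> 'a \<Rightarrow> 'a ^ 4 ^ 2" where
  "A1 \<alpha>1 \<alpha>2 \<alpha>4 \<beta>1 =
    vector [vector [\<alpha>1, \<alpha>2, \<alpha>2 + 1, \<alpha>4],
            vector [\<beta>1, -\<alpha>1, -\<alpha>1 + 1, -\<alpha>2]]"

definition A2 :: "'a::field \<Rightarrow> 'a \<Rightarrow> 'a \<Rightarrow> 'a ^ 4 ^ 2" where
  "A2 \<alpha>1 \<beta>1 \<beta>2 =
    vector [vector [\<alpha>1, 0, 0, 1],
            vector [\<beta>1, \<beta>2, 1 - \<alpha>1, 0]]"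

definition A3 :: "'a::field \<Rightarrow> 'a \<Rightarrow> 'a ^ 4 ^ 2" where
  "A3 \<beta>1 \<beta>2 =
    vector [vector [0, 1, 1, 0],
            vector [\<beta>1, \<beta>2, 1, -1]]"

definition A4 :: "'a::field \<Rightarrow> 'a \<Rightarrow> 'a ^ 4 ^ 2" where
  "A4 \<alpha>1 \<beta>2 =
    vector [vector [\<alpha>1, 0, 0, 0],
            vector [0, \<beta>2, 1 - \<alpha>1, 0]]"

definition A5 :: "'a::field \<Rightarrow> 'a ^ 4 ^ 2" where
  "A5 \<alpha>1 =
    vector [vector [\<alpha>1, 0, 0, 0],
            vector [1, 2 * \<alpha>1 - 1, 1 - \<alpha>1, 0]]"

definition A6 :: "'a::field \<Rightarrow> 'a \<Rightarrow> 'a ^ 4 ^ 2" where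
  "A6 \<alpha>1 \<beta>1 =
    vector [vector [\<alpha>1, 0, 0, 1],
            vector [\<beta>1, 1 - \<alpha>1, -\<alpha>1, 0]]"

definition A7 :: "'a::field \<Rightarrow> 'a ^ 4 ^ 2" where
  "A7 \<beta>1 =
    vector [vector [0, 1, 1, 0],
            vector [\<beta>1, 1, 0, -1]]"

definition A8 :: "'a::field \<Rightarrow> 'a ^ 4 ^ 2" where
  "A8 \<alpha>1 =
    vector [vector [\<alpha>1, 0, 0, 0],
            vector [0, 1 - \<alpha>1, -\<alpha>1, 0]]"

definition A9 :: "'a::field ^ 4 ^ 2" where
  "A9 =
    vector [vector [1 / 3, 0, 0, 0],
            vector [1, 2 / 3, -(1 / 3), 0]]"

definition A10 :: "'a::field ^ 4 ^ 2" where
  "A10 =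
    vector [vector [0, 1, 1, 0],
            vector [0, 0, 0, -1]]"

definition A11 :: "'a::field ^ 4 ^ 2" where
  "A11 =
    vector [vector [0, 1, 1, 0],
            vector [1, 0, 0, -1]]"

definition A12 :: "'a::field ^ 4 ^ 2" where
  "A12 =
    vector [vector [0, 0, 0, 0],
            vector [1, 0, 0, 0]]"

text \<open>The families in characteristic 2.\<close>

definition A1_2 :: "'a::field \<Rightarrow> 'a \<Rightarrow> 'a \<Rightarrow> 'a \<Rightarrow> 'a ^ 4 ^ 2" where
  "A1_2 \<alpha>1 \<alpha>2 \<alpha>4 \<beta>1 =
    vector [vector [\<alpha>1, \<alpha>2, \<alpha>2 + 1, \<alpha>4],
            vector [\<beta>1, -\<alpha>1, -\<alpha>1 + 1, -\<alpha>2]]"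

definition A2_2 :: "'a::field \<Rightarrow> 'a \<Rightarrow> 'a \<Rightarrow> 'a ^ 4 ^ 2" where
  "A2_2 \<alpha>1 \<beta>1 \<beta>2 =
    vector [vector [\<alpha>1, 0, 0, 1],
            vector [\<beta>1, \<beta>2, 1 - \<alpha>1, 0]]"

definition A3_2 :: "'a::field \<Rightarrow> 'a \<Rightarrow> 'a ^ 4 ^ 2" where
  "A3_2 \<alpha>1 \<beta>2 =
    vector [vector [\<alpha>1, 1, 1, 0],
            vector [0, \<beta>2, 1 - \<alpha>1, 1]]"

definition A4_2 :: "'a::field \<Rightarrow> 'a \<Rightarrow> 'a ^ 4 ^ 2" where
  "A4_2 \<alpha>1 \<beta>2 =
    vector [vector [\<alpha>1, 0, 0, 0],
            vector [0, \<beta>2, 1 - \<alpha>1, 0]]"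

definition A5_2 :: "'a::field \<Rightarrow> 'a ^ 4 ^ 2" where
  "A5_2 \<alpha>1 =
    vector [vector [\<alpha>1, 0, 0, 0],
            vector [1, 1, 1 - \<alpha>1, 0]]"

definition A6_2 :: "'a::field \<Rightarrow> 'a \<Rightarrow> 'a ^ 4 ^ 2" where
  "A6_2 \<alpha>1 \<beta>1 =
    vector [vector [\<alpha>1, 0, 0, 1],
            vector [\<beta>1, 1 - \<alpha>1, -\<alpha>1, 0]]"

definition A7_2 :: "'a::field \<Rightarrow> 'a ^ 4 ^ 2" where
  "A7_2 \<alpha>1 =
    vector [vector [\<alpha>1, 1, 1, 0],
            vector [0, 1 - \<alpha>1, -\<alpha>1, -1]]"

definition A8_2 :: "'a::field \<Rightarrow> 'a ^ 4 ^ 2" where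
  "A8_2 \<alpha>1 =
    vector [vector [\<alpha>1, 0, 0, 0],
            vector [0, 1 - \<alpha>1, -\<alpha>1, 0]]"

definition A9_2 :: "'a::field ^ 4 ^ 2" where
  "A9_2 =
    vector [vector [1, 0, 0, 0],
            vector [1, 0, 1, 0]]"

definition A10_2 :: "'a::field ^ 4 ^ 2" where
  "A10_2 =
    vector [vector [0, 1, 1, 0],
            vector [0, 0, 0, -1]]"

definition A11_2 :: "'a::field ^ 4 ^ 2" where
  "A11_2 =
    vector [vector [1, 1, 1, 0],
            vector [0, -1, -1, -1]]"

definition A12_2 :: "'a::field ^ 4 ^ 2" where
  "A12_2 =
    vector [vector [0, 0, 0, 0],
            vector [1, 0, 0, 0]]"

text \<open>The families in characteristic 3.\<close>

definition A1_3 :: "'a::field \<Rightarrow> 'a \<Rightarrow> 'a \<Rightarrow> 'a \<Rightarrow> 'a ^ 4 ^ 2" where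
  "A1_3 \<alpha>1 \<alpha>2 \<alpha>4 \<beta>1 =
    vector [vector [\<alpha>1, \<alpha>2, \<alpha>2 + 1, \<alpha>4],
            vector [\<beta>1, -\<alpha>1, -\<alpha>1 + 1, -\<alpha>2]]"

definition A2_3 :: "'a::field \<Rightarrow> 'a \<Rightarrow> 'a \<Rightarrow> 'a ^ 4 ^ 2" where
  "A2_3 \<alpha>1 \<beta>1 \<beta>2 =
    vector [vector [\<alpha>1, 0, 0, 1],
            vector [\<beta>1, \<beta>2, 1 - \<alpha>1, 0]]"

definition A3_3 :: "'a::field \<Rightarrow> 'a \<Rightarrow> 'a ^ 4 ^ 2" where
  "A3_3 \<beta>1 \<beta>2 =
    vector [vector [0, 1, 1, 0],
            vector [\<beta>1, \<beta>2, 1, -1]]"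

definition A4_3 :: "'a::field \<Rightarrow> 'a \<Rightarrow> 'a ^ 4 ^ 2" where
  "A4_3 \<alpha>1 \<beta>2 =
    vector [vector [\<alpha>1, 0, 0, 0],
            vector [0, \<beta>2, 1 - \<alpha>1, 0]]"

definition A5_3 :: "'a::field \<Rightarrow> 'a ^ 4 ^ 2" where
  "A5_3 \<alpha>1 =
    vector [vector [\<alpha>1, 0, 0, 0],
            vector [1, -1 - \<alpha>1, 1 - \<alpha>1, 0]]"

definition A6_3 :: "'a::field \<Rightarrow> 'a \<Rightarrow> 'a ^ 4 ^ 2" where
  "A6_3 \<alpha>1 \<beta>1 =
    vector [vector [\<alpha>1, 0, 0, 1],
            vector [\<beta>1, 1 - \<alpha>1, -\<alpha>1, 0]]"

definition A7_3 :: "'a::field \<Rightarrow> 'a ^ 4 ^ 2" where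
  "A7_3 \<beta>1 =
    vector [vector [0, 1, 1, 0],
            vector [\<beta>1, 1, 0, -1]]"

definition A8_3 :: "'a::field \<Rightarrow> 'a ^ 4 ^ 2" where
  "A8_3 \<alpha>1 =
    vector [vector [\<alpha>1, 0, 0, 0],
            vector [0, 1 - \<alpha>1, -\<alpha>1, 0]]"

definition A9_3 :: "'a::field ^ 4 ^ 2" where
  "A9_3 =
    vector [vector [0, 1, 1, 0],
            vector [1, 0, 0, -1]]"

definition A10_3 :: "'a::field ^ 4 ^ 2" where
  "A10_3 =
    vector [vector [0, 1, 1, 0],
            vector [0, 0, 0, -1]]"

definition A11_3 :: "'a::field ^ 4 ^ 2" where
  "A11_3 =
    vector [vector [1, 0, 0, 0],
            vector [1, -1, -1, 0]]"

definition A12_3 :: "'a::field ^ 4 ^ 2" where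
  "A12_3 =
    vector [vector [0, 0, 0, 0],
            vector [1, 0, 0, 0]]"

end

theory Submission
  imports Defs
begin

text \<open>An element \<open>e\<close> is a left quasiunit iff \<open>D = L\<^sub>e - id\<close> is a derivation, where \<open>L\<^sub>e\<close> and \<open>R\<^sub>e\<close> are the
  multiplications by \<open>e\<close> on the left and on the right. For a derivation \<open>D\<close> the commutators are
  \<open>[D, L\<^sub>u] = L\<^bsub>D u\<^esub>\<close> and \<open>[D, R\<^sub>u] = R\<^bsub>D u\<^esub>\<close>, so the linear forms \<open>u \<mapsto> tr L\<^sub>u\<close> and \<open>u \<mapsto> tr R\<^sub>u\<close> vanish on
  the range of \<open>D\<close>. In almost all families one of these forms is the first coordinate, which leaves
  only the second row of \<open>D\<close> to be determined; for \<open>A1\<close> the two forms are independent, so that \<open>D = 0\<close>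
  and the left quasiunits are the left units.\<close>

section \<open>Coordinates and the derivation criterion\<close>

definition msc :: "'a::field \<Rightarrow> 'a \<Rightarrow> 'a \<Rightarrow> 'a \<Rightarrow> 'a \<Rightarrow> 'a \<Rightarrow> 'a \<Rightarrow> 'a \<Rightarrow> 'a ^ 4 ^ 2" where
  "msc a1 a2 a3 a4 b1 b2 b3 b4 = vector [vector [a1, a2, a3, a4], vector [b1, b2, b3, b4]]"

lemma msc_mult_msc:
  "msc_mult (msc a1 a2 a3 a4 b1 b2 b3 b4) u v $ 1 =
     a1 * (u $ 1 * v $ 1) + a2 * (u $ 1 * v $ 2) + a3 * (u $ 2 * v $ 1) + a4 * (u $ 2 * v $ 2)"
  "msc_mult (msc a1 a2 a3 a4 b1 b2 b3 b4) u v $ 2 =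
     b1 * (u $ 1 * v $ 1) + b2 * (u $ 1 * v $ 2) + b3 * (u $ 2 * v $ 1) + b4 * (u $ 2 * v $ 2)"
  by (simp_all add: msc_mult_def msc_def matrix_vector_mult_def sum_4 vec_4_nth)

lemma vector_2_eq_iff: "vector [x, y] = (v :: 'a::zero ^ 2) \<longleftrightarrow> v $ 1 = x \<and> v $ 2 = y"
  by (auto simp: vec_eq_iff forall_2)

lemma e_nth: "e1 $ 1 = 1" "e1 $ 2 = 0" "e2 $ 1 = 0" "e2 $ 2 = 1"
  by (simp_all add: e1_def e2_def axis_def)

text \<open>The criteria below speak of explicit vectors \<open>vector [x, y]\<close>; this reduces
  equality of solution sets to such vectors.\<close>

lemma set_vec_2_eq_iff:
  fixes S T :: "('a::zero ^ 2) set"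
  shows "S = T \<longleftrightarrow> (\<forall>x y. vector [x, y] \<in> S \<longleftrightarrow> vector [x, y] \<in> T)"
proof
  assume *: "\<forall>x y. vector [x, y] \<in> S \<longleftrightarrow> vector [x, y] \<in> T"
  have "v \<in> S \<longleftrightarrow> v \<in> T" for v
    using *[rule_format, of "v $ 1" "v $ 2"] vector_2_eq_iff[of "v $ 1" "v $ 2" v] by simp
  then show "S = T" by blast
qed simp

text \<open>\<open>D e1 = p e1 + r e2\<close>, \<open>D e2 = q e1 + s e2\<close> is a derivation: one line for each coordinate of
  \<open>D (e\<^sub>i e\<^sub>j) = (D e\<^sub>i) e\<^sub>j + e\<^sub>i (D e\<^sub>j)\<close>, after cancellation of common terms.\<close>

definition derivation_matrix where
  "derivation_matrix a1 a2 a3 a4 b1 b2 b3 b4 p q r s \<longleftrightarrow>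
     a1 * p + b1 * q = 2 * (p * a1) + r * (a2 + a3) \<and>
     a1 * r + b1 * s = 2 * (p * b1) + r * (b2 + b3) \<and>
     b2 * q = r * a4 + q * a1 + s * a2 \<and>
     a2 * r = p * b2 + r * b4 + q * b1 \<and>
     b3 * q = q * a1 + s * a3 + r * a4 \<and>
     a3 * r = q * b1 + p * b3 + r * b4 \<and>
     a4 * p + b4 * q = q * (a2 + a3) + 2 * (s * a4) \<and>
     a4 * r + b4 * s = q * (b2 + b3) + 2 * (s * (b4 :: 'a::field))"

text \<open>The last four arguments are the entries \<open>p\<close>, \<open>q\<close>,
  \<open>r\<close>, \<open>s\<close> of \<open>D = L_e - id\<close> for
  \<open>e = x e1 + y e2\<close>. The defect of the Leibniz rule is bilinear in \<open>u\<close> and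
  \<open>v\<close>, hence a combination of its values on the four pairs of basis vectors.\<close>

lemma left_quasiunits_msc:
  fixes a1 :: "'a::field"
  shows "vector [x, y] \<in> left_quasiunits (msc a1 a2 a3 a4 b1 b2 b3 b4) \<longleftrightarrow>
    derivation_matrix a1 a2 a3 a4 b1 b2 b3 b4
      (a1 * x + a3 * y - 1) (a2 * x + a4 * y) (b1 * x + b3 * y) (b2 * x + b4 * y - 1)"
  (is "?L \<longleftrightarrow> ?R")
proof -
  let ?M = "msc a1 a2 a3 a4 b1 b2 b3 b4" and ?e = "vector [x, y] :: 'a ^ 2"
  let ?P = "\<lambda>u v. msc_mult ?M ?e (msc_mult ?M u v) =
    msc_mult ?M (msc_mult ?M ?e u) v + msc_mult ?M u (msc_mult ?M ?e v) - msc_mult ?M u v"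
  have L: "?L \<longleftrightarrow> (\<forall>u v. ?P u v)"
    by (simp add: left_quasiunits_def left_quasiunit_def)
  show ?thesis
  proof
    assume ?L
    then have "?P e1 e1" "?P e1 e2" "?P e2 e1" "?P e2 e2" using L by blast+
    then show ?R
      unfolding vec_eq_iff forall_2 derivation_matrix_def
      by (simp add: msc_mult_msc e_nth) (intro conjI; (elim conjE)?; algebra)
  next
    assume ?R
    then have "?P u v" for u v
      unfolding vec_eq_iff forall_2 derivation_matrix_def
      by (simp add: msc_mult_msc) (intro conjI; (elim conjE)?; algebra)
    then show ?L using L by blast
  qed
qed

text \<open>A commutator has trace zero: the first two equations are \<open>tr L_u = 0\<close> for
  \<open>u = D e1\<close> and \<open>u = D e2\<close>, the last two are \<open>tr R_u = 0\<close>
  for the same \<open>u\<close>.\<close>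

lemma derivation_matrix_trace:
  assumes "derivation_matrix a1 a2 a3 a4 b1 b2 b3 b4 p q r (s :: 'a::field)"
  shows "(a1 + b2) * p + (a3 + b4) * r = 0" "(a1 + b2) * q + (a3 + b4) * s = 0"
    "(a1 + b3) * p + (a2 + b4) * r = 0" "(a1 + b3) * q + (a2 + b4) * s = 0"
  using assms unfolding derivation_matrix_def by algebra+

text \<open>The assumption says that \<open>tr R\<close> or \<open>tr L\<close> is the first coordinate.\<close>

lemma left_quasiunits_msc_trace:
  fixes a1 :: "'a::field"
  assumes "a1 + b3 = 1 \<and> a2 + b4 = 0 \<or> a1 + b2 = 1 \<and> a3 + b4 = 0"
  shows "vector [x, y] \<in> left_quasiunits (msc a1 a2 a3 a4 b1 b2 b3 b4) \<longleftrightarrow>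
    a1 * x + a3 * y = 1 \<and> a2 * x + a4 * y = 0 \<and>
    derivation_matrix a1 a2 a3 a4 b1 b2 b3 b4 0 0 (b1 * x + b3 * y) (b2 * x + b4 * y - 1)"
proof -
  \<comment> \<open>\<open>p\<close> and \<open>q\<close> are the first coordinates of
    \<open>D e1\<close> and \<open>D e2\<close>, so two of the four trace equations become
    \<open>p = 0\<close> and \<open>q = 0\<close>.\<close>
  have "p = 0 \<and> q = 0" if "derivation_matrix a1 a2 a3 a4 b1 b2 b3 b4 p q r s" for p q r s
    using derivation_matrix_trace[OF that] assms by auto
  then show ?thesis
    unfolding left_quasiunits_msc by fastforce
qed

section \<open>Left quasiunits family by family\<close>

lemma mem_left_quasiunits_A1:
  "vector [x, y] \<in> left_quasiunits (A1 a1 a2 a4 b1 :: 'a::field ^ 4 ^ 2) \<longleftrightarrow>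
    y = 2 \<and> b1 * x = 2 * (a1 - 1) \<and> a1 * x + 2 * a2 + 1 = 0 \<and> a2 * x + 2 * a4 = 0"
proof -
  have "A1 a1 a2 a4 b1 = msc a1 a2 (a2 + 1) a4 b1 (- a1) (- a1 + 1) (- a2)"
    by (simp add: A1_def msc_def)
  then have "vector [x, y] \<in> left_quasiunits (A1 a1 a2 a4 b1) \<longleftrightarrow>
    a1 * x + (a2 + 1) * y = 1 \<and> a2 * x + a4 * y = 0 \<and>
    derivation_matrix a1 a2 (a2 + 1) a4 b1 (- a1) (- a1 + 1) (- a2) 0 0
      (b1 * x + (- a1 + 1) * y) (- a1 * x + - a2 * y - 1)"
    by (simp add: left_quasiunits_msc_trace del: mult_minus_left)
  \<comment> \<open>Besides \<open>tr R\<close>, the form \<open>tr L\<close> now enters: it is the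
    second coordinate, so \<open>r\<close> and \<open>s\<close> vanish too. Concretely,
    \<open>a3 - a2 = 1\<close>, and subtracting the equations for \<open>e1 e2\<close> from those
    for \<open>e2 e1\<close> leaves \<open>r = 0\<close> and \<open>s = 0\<close>.\<close>
  also have "\<dots> \<longleftrightarrow> a1 * x + (a2 + 1) * y = 1 \<and> a2 * x + a4 * y = 0 \<and>
    b1 * x + (- a1 + 1) * y = 0 \<and> - a1 * x + - a2 * y - 1 = 0"
    (is "?L \<longleftrightarrow> ?R")
  proof
    assume ?L
    then show ?R unfolding derivation_matrix_def by (intro conjI; algebra)
  qed (simp add: derivation_matrix_def)
  \<comment> \<open>The sum of the first and the last equation is \<open>y - 1 = 1\<close>; the
    others are rewritten with \<open>y = 2\<close>.\<close>
  also have "\<dots> \<longleftrightarrow> y = 2 \<and> b1 * x = 2 * (a1 - 1) \<and> a1 * x + 2 * a2 + 1 = 0 \<and> a2 * x + 2 * a4 = 0"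
    (is "?L \<longleftrightarrow> ?R")
  proof
    assume ?L
    then show ?R by (intro conjI; algebra)
  next
    assume ?R
    then have "y = 2" "b1 * x = 2 * (a1 - 1)" "a1 * x = - (2 * a2 + 1)" "a2 * x = - (2 * a4)"
      by (simp_all only: eq_neg_iff_add_eq_0 add.assoc)
    note * = this
    show ?L by (simp add: * algebra_simps)
  qed
  finally show ?thesis .
qed

text \<open>The equation \<open>b1 * x = 2 * (a1 - 1)\<close> governs the cases. For
  \<open>b1 \<noteq> 0\<close> it determines \<open>x\<close>, and the two remaining equations fix
  \<open>a2\<close> and \<open>a4\<close>. For \<open>b1 = 0\<close> it forces
  \<open>a1 = 1\<close>; then \<open>x\<close> comes from the next equation and the last one fixes
  \<open>a4\<close>.\<close>

lemma left_quasiunits_A1: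
  fixes a1 :: "'a::field"
  assumes "(2 :: 'a) \<noteq> 0"
  shows "left_quasiunits (A1 a1 a2 a4 b1) =
    (if b1 \<noteq> 0 \<and> a2 = - ((2 * a1 * (a1 - 1) + b1) / (2 * b1)) \<and> a4 = - ((2 * a2 * (a1 - 1)) / (2 * b1))
     then {(2 * (a1 - 1) / b1) *s e1 + 2 *s e2}
     else if a1 = 1 \<and> a4 = a2 * (1 + 2 * a2) / 2 \<and> b1 = 0
     then {(- (1 + 2 * a2)) *s e1 + 2 *s e2}
     else {})"
proof (cases "b1 = 0")
  case True
  have "y = 2 \<and> 0 = 2 * (a1 - 1) \<and> a1 * x + 2 * a2 + 1 = 0 \<and> a2 * x + 2 * a4 = 0 \<longleftrightarrow>
    y = 2 \<and> a1 = 1 \<and> x = - (1 + 2 * a2) \<and> 2 * a4 = a2 * (1 + 2 * a2)" (is "?L \<longleftrightarrow> ?R") for x y :: 'a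
  proof
    assume ?L
    then have "a1 = 1" using assms by simp
    moreover from this \<open>?L\<close> have "x + (1 + 2 * a2) = 0" "y = 2" "a2 * x + 2 * a4 = 0"
      by (simp_all add: add_ac)
    moreover from this have "x = - (1 + 2 * a2)"
      by (simp only: eq_neg_iff_add_eq_0)
    moreover from calculation have "2 * a4 = a2 * (1 + 2 * a2)" by algebra
    ultimately show ?R by simp
  next
    assume ?R
    then have *: "y = 2" "a1 = 1" "x = - (1 + 2 * a2)" "2 * a4 = a2 * (1 + 2 * a2)"
      by blast+
    show ?L by (simp only: *) (simp add: algebra_simps)
  qed
  moreover have "2 * a4 = a2 * (1 + 2 * a2) \<longleftrightarrow> a4 = a2 * (1 + 2 * a2) / 2"
    using assms by (simp add: nonzero_eq_divide_eq mult.commute)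
  ultimately show ?thesis
    using True unfolding set_vec_2_eq_iff mem_left_quasiunits_A1
    by (auto simp: vector_2_eq_iff e_nth)
next
  case False
  have "y = 2 \<and> b1 * x = 2 * (a1 - 1) \<and> a1 * x + 2 * a2 + 1 = 0 \<and> a2 * x + 2 * a4 = 0 \<longleftrightarrow>
    y = 2 \<and> b1 * x = 2 * (a1 - 1) \<and> 2 * b1 * a2 = - (2 * a1 * (a1 - 1) + b1) \<and> b1 * a4 = - (a2 * (a1 - 1))"
    (is "?L \<longleftrightarrow> ?R") for x y :: 'a
  proof
    assume ?L
    then have *: "b1 * x = 2 * (a1 - 1)" "a1 * x + 2 * a2 + 1 = 0" "a2 * x + 2 * a4 = 0"
      by blast+
    \<comment> \<open>Multiplication by \<open>b1\<close> allows \<open>b1 * x\<close> to be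
      replaced by \<open>2 * (a1 - 1)\<close>, which eliminates \<open>x\<close>; the factor 2 in
      the second result is cancelled afterwards.\<close>
    have "2 * b1 * a2 = b1 * (a1 * x + 2 * a2 + 1) - a1 * (b1 * x) - b1"
      and "2 * (b1 * a4) = b1 * (a2 * x + 2 * a4) - a2 * (b1 * x)"
      by (simp_all add: algebra_simps)
    then have "2 * b1 * a2 = - (2 * a1 * (a1 - 1) + b1)" "2 * (b1 * a4) = 2 * (- (a2 * (a1 - 1)))"
      unfolding * by (simp_all add: algebra_simps)
    with \<open>?L\<close> show ?R
      using assms unfolding mult_cancel_left by blast
  next
    assume ?R
    then have "b1 * x = 2 * (a1 - 1)" "2 * b1 * a2 = - (2 * a1 * (a1 - 1) + b1)"
      "b1 * a4 = - (a2 * (a1 - 1))"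
      by blast+
    then have "b1 * (a1 * x + 2 * a2 + 1) = 0" "b1 * (a2 * x + 2 * a4) = 0"
      by algebra+
    with \<open>?R\<close> show ?L using False by simp
  qed
  moreover have "2 * b1 * a2 = - k \<longleftrightarrow> a2 = - (k / (2 * b1))" for k
    using assms False nonzero_eq_divide_eq[of "2 * b1" a2 "- k"] by (simp add: mult_ac)
  moreover have "b1 * a4 = - k \<longleftrightarrow> a4 = - (2 * k / (2 * b1))" for k
    using assms False nonzero_eq_divide_eq[of b1 a4 "- k"] by (simp add: mult_ac)
  moreover have "b1 * x = k \<longleftrightarrow> x = k / b1" for x k
    using False by (simp add: nonzero_eq_divide_eq mult.commute)
  ultimately have "vector [x, y] \<in> left_quasiunits (A1 a1 a2 a4 b1) \<longleftrightarrow> y = 2 \<and> x = 2 * (a1 - 1) / b1 \<and>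
      a2 = - ((2 * a1 * (a1 - 1) + b1) / (2 * b1)) \<and> a4 = - ((2 * a2 * (a1 - 1)) / (2 * b1))" for x y
    unfolding mem_left_quasiunits_A1 by (simp only: mult.assoc)
  then show ?thesis
    using False unfolding set_vec_2_eq_iff
    by (simp add: vector_2_eq_iff e_nth) blast
qed

text \<open>With \<open>2 = 0\<close> the conditions become \<open>y = 0\<close>,
  \<open>a1 * x = - 1\<close>, \<open>b1 * x = 0\<close> and \<open>a2 * x = 0\<close>. Since
  \<open>x\<close> is nonzero, \<open>b1\<close> and \<open>a2\<close> vanish, and \<open>a4\<close>
  stays free.\<close>

lemma left_quasiunits_A1_char_2:
  fixes a1 :: "'a::field"
  assumes "(2 :: 'a) = 0"
  shows "left_quasiunits (A1 a1 a2 a4 b1) =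
    (if a1 \<noteq> 0 \<and> a2 = 0 \<and> b1 = 0 then {(- (1 / a1)) *s e1} else {})"
  unfolding set_vec_2_eq_iff mem_left_quasiunits_A1
  using assms by (auto simp: vector_2_eq_iff e_nth field_simps; simp add: add_eq_0_iff)

text \<open>\<open>tr R\<close> is the first coordinate. As \<open>e2 e2 = e1\<close>, the vector
  \<open>D e1 = r e2\<close> must equal \<open>2 s e1\<close>, so \<open>r = 0\<close> and
  \<open>2 * s = 0\<close>. The latter is void when \<open>2 = 0\<close>, whence the alternative in
  the condition.\<close>

lemma left_quasiunits_A2:
  "left_quasiunits (A2 a1 b1 b2 :: 'a::field ^ 4 ^ 2) =
    (if a1 \<noteq> 0 \<and> b1 = 0 \<and> ((2 :: 'a) = 0 \<or> b2 = a1) then {(1 / a1) *s e1} else {})"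
proof -
  have "A2 a1 b1 b2 = msc a1 0 0 1 b1 b2 (1 - a1) 0"
    by (simp add: A2_def msc_def)
  then have "vector [x, y] \<in> left_quasiunits (A2 a1 b1 b2) \<longleftrightarrow>
      a1 * x = 1 \<and> y = 0 \<and> b1 * x = 0 \<and> 2 * (b2 * x - 1) = 0" for x y
    by (auto simp: left_quasiunits_msc_trace derivation_matrix_def)
  \<comment> \<open>Multiplying \<open>b2 * x - 1\<close> by \<open>a1\<close> gives
    \<open>b2 - a1\<close>, and multiplying that by \<open>x\<close> leads back.\<close>
  moreover have "2 * (b2 * x - 1) = 0 \<longleftrightarrow> 2 * (b2 - a1) = 0" if "a1 * x = 1" for x
    using that by algebra
  ultimately have "vector [x, y] \<in> left_quasiunits (A2 a1 b1 b2) \<longleftrightarrow>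
      a1 * x = 1 \<and> y = 0 \<and> b1 * x = 0 \<and> ((2 :: 'a) = 0 \<or> b2 = a1)" for x y
    by auto
  then show ?thesis
    unfolding set_vec_2_eq_iff
    by (auto simp: vector_2_eq_iff e_nth eq_divide_eq divide_eq_eq mult.commute)
qed

text \<open>\<open>p = q = 0\<close> gives \<open>x = 0\<close> and \<open>y = 1\<close>, hence
  \<open>r = 1\<close>, whereas the first coordinate of \<open>D (e1 e1)\<close> demands
  \<open>2 * r = 0\<close>.\<close>

lemma left_quasiunits_A3:
  assumes "(2 :: 'a) \<noteq> 0"
  shows "left_quasiunits (A3 b1 b2 :: 'a::field ^ 4 ^ 2) = {}"
proof -
  have "A3 b1 b2 = msc 0 1 1 0 b1 b2 1 (- 1)"
    by (simp add: A3_def msc_def)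
  then show ?thesis
    unfolding set_vec_2_eq_iff using assms
    by (auto simp: left_quasiunits_msc_trace derivation_matrix_def)
qed

text \<open>\<open>a2 + b4 = 1 + 1\<close> vanishes only because \<open>2 = 0\<close>. Then
  \<open>x = 0\<close>, \<open>y = 1\<close>, \<open>r = 1 - a1\<close>, \<open>s = 0\<close>, and
  only the second coordinate of \<open>D (e1 e1)\<close> remains; modulo 2 it factors as
  \<open>(1 - a1) * (b2 - 1) = 0\<close>.\<close>

lemma left_quasiunits_A3_2:
  assumes "(2 :: 'a) = 0"
  shows "left_quasiunits (A3_2 a1 b2 :: 'a::field ^ 4 ^ 2) = (if a1 = 1 \<or> b2 = 1 then {e2} else {})"
proof -
  have "1 + (1 :: 'a) = 0" using assms by simp
  have "A3_2 a1 b2 = msc a1 1 1 0 0 b2 (1 - a1) 1"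
    by (simp add: A3_2_def msc_def)
  then have "vector [x, y] \<in> left_quasiunits (A3_2 a1 b2) \<longleftrightarrow>
      x = 0 \<and> y = 1 \<and> a1 * (1 - a1) = (1 - a1) * (b2 + (1 - a1))" for x y
    using assms \<open>1 + 1 = 0\<close> by (auto simp: left_quasiunits_msc_trace derivation_matrix_def)
  moreover have "a1 * (1 - a1) = (1 - a1) * (b2 + (1 - a1)) \<longleftrightarrow> (1 - a1) * (b2 - 1) = 0"
  proof -
    have "(1 - a1) * (b2 - 1) =
        (1 - a1) * (b2 + (1 - a1)) - a1 * (1 - a1) + 2 * ((1 - a1) * (a1 - 1))"
      by (simp add: algebra_simps)
    then show ?thesis using assms by auto
  qed
  ultimately show ?thesis
    unfolding set_vec_2_eq_iff by (auto simp: vector_2_eq_iff e_nth)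
qed

text \<open>Once \<open>p = q = 0\<close>, only the second coordinate of \<open>D (e1 e1)\<close> is
  left, a condition on \<open>r = (1 - a1) * y\<close>. Its factors decide whether \<open>y\<close>
  is free or zero.\<close>

lemma left_quasiunits_A4:
  "left_quasiunits (A4 a1 b2 :: 'a::field ^ 4 ^ 2) =
    (if a1 = 0 then {}
     else if a1 = 1 \<or> b2 = 2 * a1 - 1 then {(1 / a1) *s e1 + t *s e2 | t. True}
     else {(1 / a1) *s e1})"
proof -
  have "A4 a1 b2 = msc a1 0 0 0 0 b2 (1 - a1) 0"
    by (simp add: A4_def msc_def)
  then have "vector [x, y] \<in> left_quasiunits (A4 a1 b2) \<longleftrightarrow>
      a1 * x = 1 \<and> a1 * ((1 - a1) * y) = (1 - a1) * y * (b2 + (1 - a1))" for x y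
    by (auto simp: left_quasiunits_msc_trace derivation_matrix_def)
  moreover have "a1 * ((1 - a1) * y) = (1 - a1) * y * (b2 + (1 - a1)) \<longleftrightarrow>
      (1 - a1) * y * (b2 - (2 * a1 - 1)) = 0" for y
    by algebra
  ultimately show ?thesis
    unfolding set_vec_2_eq_iff
    by (auto simp: vector_2_eq_iff e_nth eq_divide_eq divide_eq_eq mult.commute)
qed

text \<open>Because \<open>b2 + b3 = a1\<close>, the terms with \<open>r\<close> cancel in the
  second coordinate of \<open>D (e1 e1)\<close>, leaving \<open>s = 0\<close>. Then
  \<open>(2 * a1 - 1) * x = 1\<close> and \<open>a1 * x = 1\<close> give \<open>x = 1\<close> and
  \<open>a1 = 1\<close>, with \<open>y\<close> free.\<close>

lemma left_quasiunits_A5: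
  "left_quasiunits (A5 a1 :: 'a::field ^ 4 ^ 2) = (if a1 = 1 then {e1 + t *s e2 | t. True} else {})"
proof -
  have "A5 a1 = msc a1 0 0 0 1 (2 * a1 - 1) (1 - a1) 0"
    by (simp add: A5_def msc_def)
  then have "vector [x, y] \<in> left_quasiunits (A5 a1) \<longleftrightarrow>
      a1 * x = 1 \<and> a1 * (x + (1 - a1) * y) + ((2 * a1 - 1) * x - 1) =
        (x + (1 - a1) * y) * (2 * a1 - 1 + (1 - a1))" for x y
    by (auto simp: left_quasiunits_msc_trace derivation_matrix_def)
  moreover have "a1 * x = 1 \<and> a1 * (x + (1 - a1) * y) + ((2 * a1 - 1) * x - 1) =
      (x + (1 - a1) * y) * (2 * a1 - 1 + (1 - a1)) \<longleftrightarrow> a1 = 1 \<and> x = 1" (is "?L \<longleftrightarrow> ?R") for x y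
  proof
    assume ?L
    then show ?R by (intro conjI; algebra)
  qed simp
  ultimately show ?thesis
    unfolding set_vec_2_eq_iff by (auto simp: vector_2_eq_iff e_nth)
qed

text \<open>As for \<open>A2\<close>, except that \<open>tr L\<close> is now the first coordinate;
  with \<open>a1 * x = 1\<close>, the condition \<open>2 * s = 0\<close> becomes
  \<open>2 * (a1 * 2 - 1) = 0\<close>.\<close>

lemma left_quasiunits_A6:
  "left_quasiunits (A6 a1 b1 :: 'a::field ^ 4 ^ 2) =
    (if a1 \<noteq> 0 \<and> b1 = 0 \<and> ((2 :: 'a) = 0 \<or> a1 * 2 = 1) then {(1 / a1) *s e1} else {})"
proof -
  have "A6 a1 b1 = msc a1 0 0 1 b1 (1 - a1) (- a1) 0"
    by (simp add: A6_def msc_def)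
  then have "vector [x, y] \<in> left_quasiunits (A6 a1 b1) \<longleftrightarrow>
      a1 * x = 1 \<and> y = 0 \<and> b1 * x = 0 \<and> 2 * ((1 - a1) * x - 1) = 0" for x y
    by (auto simp: left_quasiunits_msc_trace derivation_matrix_def)
  moreover have "2 * ((1 - a1) * x - 1) = 0 \<longleftrightarrow> 2 * (a1 * 2 - 1) = 0" if "a1 * x = 1" for x
    using that by algebra
  ultimately have "vector [x, y] \<in> left_quasiunits (A6 a1 b1) \<longleftrightarrow>
      a1 * x = 1 \<and> y = 0 \<and> b1 * x = 0 \<and> ((2 :: 'a) = 0 \<or> a1 * 2 = 1)" for x y
    unfolding mult_eq_0_iff right_minus_eq by blast
  then show ?thesis
    unfolding set_vec_2_eq_iff
    by (auto simp: vector_2_eq_iff e_nth eq_divide_eq divide_eq_eq mult.commute)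
qed

text \<open>\<open>tr L\<close> gives \<open>x = 0\<close> and \<open>y = 1\<close>, so
  \<open>s = - 2\<close>, but \<open>D (e1 e2)\<close> requires \<open>s = 0\<close>.\<close>

lemma left_quasiunits_A7:
  assumes "(2 :: 'a) \<noteq> 0"
  shows "left_quasiunits (A7 b1 :: 'a::field ^ 4 ^ 2) = {}"
proof -
  have "A7 b1 = msc 0 1 1 0 b1 1 0 (- 1)"
    by (simp add: A7_def msc_def)
  then show ?thesis
    unfolding set_vec_2_eq_iff using assms
    by (auto simp: left_quasiunits_msc_trace derivation_matrix_def)
qed

text \<open>Here \<open>x = 0\<close>, \<open>y = 1\<close>, \<open>r = - a1\<close>, and
  \<open>s = - 2\<close> vanishes; the second coordinate of \<open>D (e1 e1)\<close> leaves a
  quadratic condition on \<open>a1\<close>.\<close>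

lemma left_quasiunits_A7_2:
  assumes "(2 :: 'a) = 0"
  shows "left_quasiunits (A7_2 a1 :: 'a::field ^ 4 ^ 2) = (if a1 = 0 \<or> a1 = 1 then {e2} else {})"
proof -
  have "- 1 = (1 :: 'a)" using assms by (simp add: neg_eq_iff_add_eq_0)
  then have "A7_2 a1 = msc a1 1 1 0 0 (1 - a1) (- a1) (- 1)"
    by (simp add: A7_2_def msc_def)
  then have "vector [x, y] \<in> left_quasiunits (A7_2 a1) \<longleftrightarrow>
      x = 0 \<and> y = 1 \<and> a1 * a1 = a1 * (1 - a1 - a1)" for x y
    using assms \<open>- 1 = 1\<close> by (auto simp: left_quasiunits_msc_trace derivation_matrix_def)
  moreover have "a1 * a1 = a1 * (1 - a1 - a1) \<longleftrightarrow> a1 * (a1 - 1) = 0"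
  proof -
    have "a1 * (a1 - 1) = a1 * a1 - a1 * (1 - a1 - a1) - 2 * (a1 * a1)"
      by (simp add: algebra_simps)
    then show ?thesis using assms by auto
  qed
  ultimately show ?thesis
    unfolding set_vec_2_eq_iff by (auto simp: vector_2_eq_iff e_nth)
qed

text \<open>With \<open>r = - a1 * y\<close>, the surviving equation is
  \<open>a1 * y * (a1 * 3 - 1) = 0\<close>. Writing \<open>a1 * 3 = 1\<close> instead of
  \<open>a1 = 1 / 3\<close> keeps the condition meaningful in characteristic 3, where it never
  holds.\<close>

lemma left_quasiunits_A8:
  "left_quasiunits (A8 a1 :: 'a::field ^ 4 ^ 2) =
    (if a1 = 0 then {}
     else if a1 * 3 = 1 then {(1 / a1) *s e1 + t *s e2 | t. True}
     else {(1 / a1) *s e1})"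
proof -
  have "A8 a1 = msc a1 0 0 0 0 (1 - a1) (- a1) 0"
    by (simp add: A8_def msc_def)
  then have "vector [x, y] \<in> left_quasiunits (A8 a1) \<longleftrightarrow>
      a1 * x = 1 \<and> a1 * (a1 * y) = a1 * y * (1 - a1 - a1)" for x y
    by (auto simp: left_quasiunits_msc_trace derivation_matrix_def)
  moreover have "a1 * (a1 * y) = a1 * y * (1 - a1 - a1) \<longleftrightarrow> a1 * y * (a1 * 3 - 1) = 0" for y
    by algebra
  ultimately show ?thesis
    unfolding set_vec_2_eq_iff
    by (auto simp: vector_2_eq_iff e_nth eq_divide_eq divide_eq_eq mult.commute)
qed

text \<open>The equation \<open>c * p = 2 * (p * c)\<close> gives \<open>p = 0\<close>, that is
  \<open>c * x = 1\<close>. Since \<open>b2 + b3 = a1\<close>, \<open>r\<close> cancels as for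
  \<open>A5\<close> and \<open>s = 2 * p = 0\<close>, that is \<open>2 * c * x = 1\<close>: a
  contradiction.\<close>

lemma left_quasiunits_A9:
  assumes "(3 :: 'a) \<noteq> 0"
  shows "left_quasiunits (A9 :: 'a::field ^ 4 ^ 2) = {}"
proof -
  define c :: 'a where "c = 1 / 3"
  have "3 * c = 1"
    using assms by (simp add: c_def)
  have "\<not> derivation_matrix c 0 0 0 1 (2 * c) (- c) 0 (c * x - 1) 0 (x - c * y) (2 * c * x - 1)" for x y
  proof
    assume "derivation_matrix c 0 0 0 1 (2 * c) (- c) 0 (c * x - 1) 0 (x - c * y) (2 * c * x - 1)"
    then have "c * (c * x - 1) + 1 * 0 = 2 * ((c * x - 1) * c) + (x - c * y) * (0 + 0)"
      and "c * (x - c * y) + 1 * (2 * c * x - 1) = 2 * ((c * x - 1) * 1) + (x - c * y) * (2 * c + - c)"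
      unfolding derivation_matrix_def by blast+
    moreover from this \<open>3 * c = 1\<close> have "c * x - 1 = 0" by algebra
    ultimately have "1 = (0 :: 'a)" by algebra
    then show False by simp
  qed
  moreover have *: "A9 = msc c 0 0 0 1 (2 * c) (- c) 0"
    by (simp add: A9_def msc_def c_def)
  ultimately show ?thesis
    unfolding set_vec_2_eq_iff * by (simp add: left_quasiunits_msc)
qed

text \<open>\<open>D (e1 e1)\<close> gives \<open>p = 2 * p\<close> and \<open>s = 2 * p\<close>,
  hence \<open>s = 0\<close>, although \<open>s = - 1\<close>.\<close>

lemma left_quasiunits_A9_2: "left_quasiunits (A9_2 :: 'a::field ^ 4 ^ 2) = {}"
proof -
  have "\<not> derivation_matrix (1 :: 'a) 0 0 0 1 0 1 0 (x - 1) 0 (x + y) (- 1)" for x y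
  proof
    assume *: "derivation_matrix (1 :: 'a) 0 0 0 1 0 1 0 (x - 1) 0 (x + y) (- 1)"
    have "1 = (0 :: 'a)"
      using * by (simp add: derivation_matrix_def) algebra
    then show False by simp
  qed
  moreover have *: "A9_2 = msc (1 :: 'a) 0 0 0 1 0 1 0"
    by (simp add: A9_2_def msc_def)
  ultimately show ?thesis
    unfolding set_vec_2_eq_iff * by (simp add: left_quasiunits_msc)
qed

text \<open>Both trace forms vanish, so the full criterion is used: \<open>e1 e2\<close> gives
  \<open>s = 0\<close>, i.e. \<open>y = - 1\<close>, and \<open>e2 e2\<close> gives
  \<open>- x = 2 * x\<close>. The condition \<open>3 * t = 0\<close> covers all characteristics at
  once.\<close>

lemma left_quasiunits_A10:
  "left_quasiunits (A10 :: 'a::field ^ 4 ^ 2) = {t *s e1 - e2 | t. 3 * t = 0}"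
proof -
  have *: "A10 = msc (0 :: 'a) 1 1 0 0 0 0 (- 1)"
    by (simp add: A10_def msc_def)
  moreover have "derivation_matrix (0 :: 'a) 1 1 0 0 0 0 (- 1) (y - 1) x 0 (- y - 1) \<longleftrightarrow>
    3 * x = 0 \<and> y = - 1" (is "?L \<longleftrightarrow> ?R") for x y
  proof
    assume ?L
    then show ?R unfolding derivation_matrix_def by (intro conjI; algebra)
  next
    assume ?R
    moreover from this have "- x = 2 * x" by algebra
    ultimately show ?L by (simp add: derivation_matrix_def mult.commute)
  qed
  ultimately show ?thesis
    unfolding set_vec_2_eq_iff *
    by (auto simp: left_quasiunits_msc vector_2_eq_iff e_nth)
qed

text \<open>\<open>D (e1 e1)\<close> yields \<open>3 * y = 1\<close> and \<open>D (e1 e2)\<close>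
  yields \<open>y = - 1\<close>; together \<open>4 = 0\<close>.\<close>

lemma left_quasiunits_A11:
  assumes "(2 :: 'a) \<noteq> 0"
  shows "left_quasiunits (A11 :: 'a::field ^ 4 ^ 2) = {}"
proof -
  have *: "A11 = msc (0 :: 'a) 1 1 0 1 0 0 (- 1)"
    by (simp add: A11_def msc_def)
  moreover have "\<not> derivation_matrix (0 :: 'a) 1 1 0 1 0 0 (- 1) (y - 1) x x (- y - 1)" for x y
  proof
    assume "derivation_matrix 0 1 1 0 1 0 0 (- 1) (y - 1) x x (- y - 1)"
    then have "3 * y = 1" "y + 1 = 0"
      by (simp_all add: derivation_matrix_def)
    moreover have "2 * 2 = 3 * (y + 1) - (3 * y - 1)"
      by (simp add: algebra_simps)
    ultimately have "2 * 2 = (0 :: 'a)" by simp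
    then show False using assms unfolding mult_eq_0_iff by blast
  qed
  ultimately show ?thesis
    unfolding set_vec_2_eq_iff * by (simp add: left_quasiunits_msc)
qed

text \<open>Modulo 2, \<open>e1 e1\<close> forces \<open>p = 0\<close> and \<open>r = 0\<close>, and
  \<open>e2 e2\<close> forces \<open>q = 0\<close>: then \<open>x + y = 1\<close> with
  \<open>x = y = 0\<close>.\<close>

lemma left_quasiunits_A11_2:
  assumes "(2 :: 'a) = 0"
  shows "left_quasiunits (A11_2 :: 'a::field ^ 4 ^ 2) = {}"
proof -
  have msc: "A11_2 = msc (1 :: 'a) 1 1 0 0 (- 1) (- 1) (- 1)"
    by (simp add: A11_2_def msc_def)
  moreover have "\<not> derivation_matrix (1 :: 'a) 1 1 0 0 (- 1) (- 1) (- 1) (x + y - 1) x (- y) (- x - y - 1)" for x y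
  proof
    assume "derivation_matrix (1 :: 'a) 1 1 0 0 (- 1) (- 1) (- 1) (x + y - 1) x (- y) (- x - y - 1)"
    then show False
      using assms by (auto simp: derivation_matrix_def)
  qed
  ultimately show ?thesis
    unfolding set_vec_2_eq_iff msc by (simp add: left_quasiunits_msc)
qed

text \<open>\<open>D (e1 e1)\<close> gives \<open>p = 0\<close>, i.e. \<open>x = 1\<close>; its
  second coordinate loses \<open>r\<close>, whose coefficient is 3, and gives \<open>s = 0\<close>,
  i.e. \<open>x = - 1\<close>.\<close>

lemma left_quasiunits_A11_3:
  assumes "(3 :: 'a) = 0"
  shows "left_quasiunits (A11_3 :: 'a::field ^ 4 ^ 2) = {}"
proof -
  have msc: "A11_3 = msc (1 :: 'a) 0 0 0 1 (- 1) (- 1) 0"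
    by (simp add: A11_3_def msc_def)
  moreover have "\<not> derivation_matrix (1 :: 'a) 0 0 0 1 (- 1) (- 1) 0 (x - 1) 0 (x - y) (- x - 1)" for x y
  proof
    assume *: "derivation_matrix (1 :: 'a) 0 0 0 1 (- 1) (- 1) 0 (x - 1) 0 (x - y) (- x - 1)"
    have "1 = (0 :: 'a)"
      using assms * by (simp add: derivation_matrix_def) algebra
    then show False by simp
  qed
  ultimately show ?thesis
    unfolding set_vec_2_eq_iff msc by (simp add: left_quasiunits_msc)
qed

text \<open>Here \<open>p = s = - 1\<close> for every \<open>e\<close>, while
  \<open>e1 e1 = e2\<close> asks for \<open>s = 2 * p\<close>.\<close>

lemma left_quasiunits_A12: "left_quasiunits (A12 :: 'a::field ^ 4 ^ 2) = {}"
proof -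
  have msc: "A12 = msc (0 :: 'a) 0 0 0 1 0 0 0"
    by (simp add: A12_def msc_def)
  moreover have "1 \<noteq> (2 :: 'a)"
    by (metis add_cancel_right_right one_add_one zero_neq_one)
  ultimately show ?thesis
    unfolding set_vec_2_eq_iff msc by (simp add: left_quasiunits_msc derivation_matrix_def)
qed

section \<open>Specialization to the three characteristics\<close>

lemma prime_eq_zero_iff_CHAR:
  assumes "prime p"
  shows "of_nat p = (0 :: 'a::field) \<longleftrightarrow> CHAR('a) = p"
  using assms CHAR_not_1[where ?'a = 'a]
  by (auto simp: of_nat_eq_0_iff_char_dvd prime_nat_iff)

lemmas left_quasiunits_families = left_quasiunits_A1 left_quasiunits_A2 left_quasiunits_A3 left_quasiunits_A4
  left_quasiunits_A5 left_quasiunits_A6 left_quasiunits_A7 left_quasiunits_A8 left_quasiunits_A9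
  left_quasiunits_A10 left_quasiunits_A11 left_quasiunits_A12

lemma families_char_2:
  "A1_2 = A1" "A2_2 = A2" "A4_2 = A4" "A6_2 = A6" "A8_2 = A8" "A10_2 = A10" "A12_2 = A12"
  by ((intro ext)?, simp add: A1_2_def A1_def A2_2_def A2_def A4_2_def A4_def A6_2_def A6_def
      A8_2_def A8_def A10_2_def A10_def A12_2_def A12_def)+

lemma minus_one_char_2: "(2 :: 'a::field) = 0 \<Longrightarrow> - 1 = (1 :: 'a)"
  by (simp add: neg_eq_iff_add_eq_0)

lemma A5_2_eq_A5: "(2 :: 'a::field) = 0 \<Longrightarrow> (A5_2 :: 'a \<Rightarrow> _) = A5"
  by (intro ext) (simp add: A5_2_def A5_def minus_one_char_2)

lemma left_quasiunits_A10_char_2: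
  assumes "(2 :: 'a::field) = 0"
  shows "left_quasiunits (A10 :: 'a ^ 4 ^ 2) = {e2}"
proof -
  have "(1 :: 'a) + 2 = 1"
    unfolding assms by simp
  then have "(3 :: 'a) = 1" by simp
  moreover have "- e2 = (e2 :: 'a ^ 2)"
    using minus_one_char_2[OF assms] by (simp add: vec_eq_iff forall_2 e_nth)
  ultimately show ?thesis
    unfolding left_quasiunits_A10 by simp
qed

text \<open>The numbering shifts in characteristic 3: the matrix \<open>A11\<close> reappears as
  \<open>A9_3\<close>. \<open>A5_3\<close> agrees with \<open>A5\<close> only modulo 3, and
  \<open>A11_3\<close> is treated on its own.\<close>

lemma families_char_3:
  "A1_3 = A1" "A2_3 = A2" "A3_3 = A3" "A4_3 = A4" "A6_3 = A6" "A7_3 = A7" "A8_3 = A8" "A10_3 = A10"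
  "A9_3 = A11" "A12_3 = A12"
  by ((intro ext)?, simp add: A1_3_def A1_def A2_3_def A2_def A3_3_def A3_def A4_3_def A4_def
      A6_3_def A6_def A7_3_def A7_def A8_3_def A8_def A9_3_def A11_def A10_3_def A10_def A12_3_def A12_def)+

lemma two_mult_char_3: "(3 :: 'a::field) = 0 \<Longrightarrow> 2 * x = - (x :: 'a)"
  using left_diff_distrib[of 3 1 x] by simp

lemma left_quasiunits_A1_char_3:
  fixes a1 :: "'a::field"
  assumes "(3 :: 'a) = 0" "(2 :: 'a) \<noteq> 0"
  shows "left_quasiunits (A1 a1 a2 a4 b1) =
    (if b1 \<noteq> 0 \<and> a2 = a1 * (1 - a1) / b1 - 1 / 2 \<and>
        a4 = a1 * (1 - a1) ^ 2 / b1 ^ 2 - (1 - a1) / (2 * b1)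
     then {((1 - a1) / b1) *s e1 + 2 *s e2}
     else if a1 = 1 \<and> a4 = a2 * (2 * a2 + 1) / 2 \<and> b1 = 0
     then {(a2 - 1) *s e1 + 2 *s e2}
     else {})"
proof -
  let ?c2 = "a1 * (1 - a1) / b1 - 1 / 2"
    and ?c4 = "a1 * (1 - a1) ^ 2 / b1 ^ 2 - (1 - a1) / (2 * b1)"
  have c2: "- ((2 * a1 * (a1 - 1) + b1) / (2 * b1)) = ?c2" if "b1 \<noteq> 0"
    using assms(2) that by (simp add: field_simps)
  \<comment> \<open>The general formula for \<open>a4\<close> refers to \<open>a2\<close>; the form
    in characteristic 3 has the value of \<open>a2\<close> substituted, hence the assumption
    \<open>a2 = ?c2\<close>.\<close>
  have c4: "- ((2 * a2 * (a1 - 1)) / (2 * b1)) = ?c4" if "b1 \<noteq> 0" "a2 = ?c2"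
  proof -
    \<comment> \<open>An opaque \<open>d\<close> in place of \<open>1 - a1\<close> keeps the powers
      of \<open>1 - a1\<close> from being expanded.\<close>
    have "d / b1 * (a1 * d / b1 - 1 / 2) = a1 * d ^ 2 / b1 ^ 2 - d / (2 * b1)" for d
      by (simp add: right_diff_distrib power2_eq_square mult_ac)
    from this[of "1 - a1"] have "(1 - a1) / b1 * a2 = ?c4"
      unfolding that(2) .
    moreover have "- ((2 * a2 * (a1 - 1)) / (2 * b1)) = (1 - a1) / b1 * a2"
      using assms(2) that(1) by (simp add: field_simps)
    ultimately show ?thesis by (simp only:)
  qed
  have "b1 \<noteq> 0 \<and> a2 = - ((2 * a1 * (a1 - 1) + b1) / (2 * b1)) \<and> a4 = - ((2 * a2 * (a1 - 1)) / (2 * b1)) \<longleftrightarrow>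
      b1 \<noteq> 0 \<and> a2 = ?c2 \<and> a4 = ?c4"
    using c2 c4 by metis
  moreover have "2 * (a1 - 1) / b1 = (1 - a1) / b1"
    by (simp only: two_mult_char_3[OF assms(1)] minus_diff_eq)
  moreover have "- (1 + 2 * a2) = a2 - 1"
    by (simp add: two_mult_char_3[OF assms(1)])
  ultimately show ?thesis
    unfolding left_quasiunits_A1[OF assms(2)] by (simp only: add.commute)
qed

lemma left_quasiunits_A6_char_3:
  fixes a1 :: "'a::field"
  assumes "(3 :: 'a) = 0" "(2 :: 'a) \<noteq> 0"
  shows "left_quasiunits (A6 a1 b1) = (if a1 = - 1 \<and> b1 = 0 then {- e1} else {})"
proof -
  have "a1 * 2 = 1 \<longleftrightarrow> a1 = - 1"
    unfolding mult.commute[of a1] two_mult_char_3[OF assms(1)] by (metis minus_minus)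
  moreover have "(1 / - 1) *s e1 = - (e1 :: 'a ^ 2)"
    by (simp add: vec_eq_iff)
  ultimately show ?thesis
    using assms(2) unfolding left_quasiunits_A6 by auto
qed

lemma A5_3_eq_A5:
  assumes "(3 :: 'a::field) = 0"
  shows "(A5_3 :: 'a \<Rightarrow> _) = A5"
proof
  fix a :: 'a
  have "2 * a - 1 = - 1 - a"
    using two_mult_char_3[OF assms, of a] by simp
  then show "A5_3 a = A5 a"
    by (simp only: A5_3_def A5_def)
qed

theorem mainTheorem7:
  assumes root: "\<And>p :: 'a::field poly. degree p = 2 \<or> degree p = 3 \<Longrightarrow> \<exists>x. poly p x = 0"
  shows
    "(CHAR('a) \<noteq> 2 \<and> CHAR('a) \<noteq> 3 \<longrightarrow>
      (\<forall>\<alpha>1 \<alpha>2 \<alpha>4 \<beta>1. \<beta>1 \<noteq> 0 \<and>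
        \<alpha>2 = - ((2 * \<alpha>1 * (\<alpha>1 - 1) + \<beta>1) / (2 * \<beta>1)) \<and>
        \<alpha>4 = - ((2 * \<alpha>2 * (\<alpha>1 - 1)) / (2 * \<beta>1)) \<longrightarrow>
        left_quasiunits (A1 \<alpha>1 \<alpha>2 \<alpha>4 \<beta>1 :: 'a ^ 4 ^ 2) = {(2 * (\<alpha>1 - 1) / \<beta>1) *s e1 + 2 *s e2}) \<and>
      (\<forall>\<alpha>2. left_quasiunits (A1 1 \<alpha>2 (\<alpha>2 * (1 + 2 * \<alpha>2) / 2) 0 :: 'a ^ 4 ^ 2) =
        {(- (1 + 2 * \<alpha>2)) *s e1 + 2 *s e2}) \<and>
      (\<forall>\<alpha>1. \<alpha>1 \<noteq> 0 \<longrightarrow>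
        left_quasiunits (A2 \<alpha>1 0 \<alpha>1 :: 'a ^ 4 ^ 2) = {(1 / \<alpha>1) *s e1}) \<and>
      (\<forall>\<beta>2. left_quasiunits (A4 1 \<beta>2 :: 'a ^ 4 ^ 2) = {e1 + t *s e2 | t. True}) \<and>
      (\<forall>\<alpha>1 \<beta>2. \<alpha>1 \<noteq> 0 \<and> \<alpha>1 \<noteq> 1 \<and> \<beta>2 \<noteq> 2 * \<alpha>1 - 1 \<longrightarrow>
        left_quasiunits (A4 \<alpha>1 \<beta>2 :: 'a ^ 4 ^ 2) = {(1 / \<alpha>1) *s e1}) \<and>
      (\<forall>\<alpha>1. \<alpha>1 \<noteq> 0 \<and> \<alpha>1 \<noteq> 1 \<longrightarrow>
        left_quasiunits (A4 \<alpha>1 (2 * \<alpha>1 - 1) :: 'a ^ 4 ^ 2) = {(1 / \<alpha>1) *s e1 + t *s e2 | t. True}) \<and>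
      (left_quasiunits (A5 1 :: 'a ^ 4 ^ 2) = {e1 + t *s e2 | t. True}) \<and>
      (left_quasiunits (A6 (1 / 2) 0 :: 'a ^ 4 ^ 2) = {2 *s e1}) \<and>
      (\<forall>\<alpha>1. \<alpha>1 \<noteq> 0 \<and> \<alpha>1 \<noteq> 1 / 3 \<longrightarrow>
        left_quasiunits (A8 \<alpha>1 :: 'a ^ 4 ^ 2) = {(1 / \<alpha>1) *s e1}) \<and>
      (left_quasiunits (A8 (1 / 3) :: 'a ^ 4 ^ 2) = {3 *s e1 + t *s e2 | t. True}) \<and>
      (left_quasiunits (A10 :: 'a ^ 4 ^ 2) = {- e2}) \<and>
      (\<forall>\<alpha>1 \<alpha>2 \<alpha>4 \<beta>1. left_quasiunits (A1 \<alpha>1 \<alpha>2 \<alpha>4 \<beta>1 :: 'a ^ 4 ^ 2) \<noteq> {} \<longleftrightarrow>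
        (\<beta>1 \<noteq> 0 \<and>
        \<alpha>2 = - ((2 * \<alpha>1 * (\<alpha>1 - 1) + \<beta>1) / (2 * \<beta>1)) \<and>
        \<alpha>4 = - ((2 * \<alpha>2 * (\<alpha>1 - 1)) / (2 * \<beta>1)))
        \<or> (\<alpha>1 = 1 \<and> \<alpha>4 = \<alpha>2 * (1 + 2 * \<alpha>2) / 2 \<and> \<beta>1 = 0)) \<and>
      (\<forall>\<alpha>1 \<beta>1 \<beta>2. left_quasiunits (A2 \<alpha>1 \<beta>1 \<beta>2 :: 'a ^ 4 ^ 2) \<noteq> {} \<longleftrightarrow>
        \<beta>1 = 0 \<and> \<beta>2 = \<alpha>1 \<and> \<alpha>1 \<noteq> 0) \<and>
      (\<forall>\<beta>1 \<beta>2. left_quasiunits (A3 \<beta>1 \<beta>2 :: 'a ^ 4 ^ 2) = {}) \<and>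
      (\<forall>\<alpha>1 \<beta>2. left_quasiunits (A4 \<alpha>1 \<beta>2 :: 'a ^ 4 ^ 2) \<noteq> {} \<longleftrightarrow>
        \<alpha>1 = 1
        \<or> (\<alpha>1 \<noteq> 0 \<and> \<alpha>1 \<noteq> 1 \<and> \<beta>2 \<noteq> 2 * \<alpha>1 - 1)
        \<or> (\<alpha>1 \<noteq> 0 \<and> \<alpha>1 \<noteq> 1 \<and> \<beta>2 = 2 * \<alpha>1 - 1)) \<and>
      (\<forall>\<alpha>1. left_quasiunits (A5 \<alpha>1 :: 'a ^ 4 ^ 2) \<noteq> {} \<longleftrightarrow>
        \<alpha>1 = 1) \<and>
      (\<forall>\<alpha>1 \<beta>1. left_quasiunits (A6 \<alpha>1 \<beta>1 :: 'a ^ 4 ^ 2) \<noteq> {} \<longleftrightarrow>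
        \<alpha>1 = 1 / 2 \<and> \<beta>1 = 0) \<and>
      (\<forall>\<beta>1. left_quasiunits (A7 \<beta>1 :: 'a ^ 4 ^ 2) = {}) \<and>
      (\<forall>\<alpha>1. left_quasiunits (A8 \<alpha>1 :: 'a ^ 4 ^ 2) \<noteq> {} \<longleftrightarrow>
        (\<alpha>1 \<noteq> 0 \<and> \<alpha>1 \<noteq> 1 / 3) \<or> \<alpha>1 = 1 / 3) \<and>
      (left_quasiunits (A9 :: 'a ^ 4 ^ 2) = {}) \<and>
      (left_quasiunits (A10 :: 'a ^ 4 ^ 2) \<noteq> {}) \<and>
      (left_quasiunits (A11 :: 'a ^ 4 ^ 2) = {}) \<and>
      (left_quasiunits (A12 :: 'a ^ 4 ^ 2) = {})) \<and>
     (CHAR('a) = 2 \<longrightarrow>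
      (\<forall>\<alpha>1 \<alpha>4. \<alpha>1 \<noteq> 0 \<longrightarrow>
        left_quasiunits (A1_2 \<alpha>1 0 \<alpha>4 0 :: 'a ^ 4 ^ 2) = {(- (1 / \<alpha>1)) *s e1}) \<and>
      (\<forall>\<alpha>1 \<beta>2. \<alpha>1 \<noteq> 0 \<longrightarrow>
        left_quasiunits (A2_2 \<alpha>1 0 \<beta>2 :: 'a ^ 4 ^ 2) = {(1 / \<alpha>1) *s e1}) \<and>
      (\<forall>\<beta>2. left_quasiunits (A3_2 1 \<beta>2 :: 'a ^ 4 ^ 2) = {e2}) \<and>
      (\<forall>\<alpha>1. left_quasiunits (A3_2 \<alpha>1 1 :: 'a ^ 4 ^ 2) = {e2}) \<and>
      (\<forall>\<beta>2. left_quasiunits (A4_2 1 \<beta>2 :: 'a ^ 4 ^ 2) = {e1 + t *s e2 | t. True}) \<and>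
      (\<forall>\<alpha>1 \<beta>2. \<alpha>1 \<noteq> 0 \<and> \<alpha>1 \<noteq> 1 \<and> \<beta>2 \<noteq> 1 \<longrightarrow>
        left_quasiunits (A4_2 \<alpha>1 \<beta>2 :: 'a ^ 4 ^ 2) = {(1 / \<alpha>1) *s e1}) \<and>
      (\<forall>\<alpha>1. \<alpha>1 \<noteq> 0 \<and> \<alpha>1 \<noteq> 1 \<longrightarrow>
        left_quasiunits (A4_2 \<alpha>1 1 :: 'a ^ 4 ^ 2) = {(1 / \<alpha>1) *s e1 + t *s e2 | t. True}) \<and>
      (left_quasiunits (A5_2 1 :: 'a ^ 4 ^ 2) = {e1 + t *s e2 | t. True}) \<and>
      (\<forall>\<alpha>1. \<alpha>1 \<noteq> 0 \<longrightarrow>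
        left_quasiunits (A6_2 \<alpha>1 0 :: 'a ^ 4 ^ 2) = {(1 / \<alpha>1) *s e1}) \<and>
      (left_quasiunits (A7_2 0 :: 'a ^ 4 ^ 2) = {e2}) \<and>
      (left_quasiunits (A7_2 1 :: 'a ^ 4 ^ 2) = {e2}) \<and>
      (\<forall>\<alpha>1. \<alpha>1 \<noteq> 0 \<and> \<alpha>1 \<noteq> 1 \<longrightarrow>
        left_quasiunits (A8_2 \<alpha>1 :: 'a ^ 4 ^ 2) = {(1 / \<alpha>1) *s e1}) \<and>
      (left_quasiunits (A8_2 1 :: 'a ^ 4 ^ 2) = {e1 + t *s e2 | t. True}) \<and>
      (left_quasiunits (A10_2 :: 'a ^ 4 ^ 2) = {e2}) \<and>
      (\<forall>\<alpha>1 \<alpha>2 \<alpha>4 \<beta>1. left_quasiunits (A1_2 \<alpha>1 \<alpha>2 \<alpha>4 \<beta>1 :: 'a ^ 4 ^ 2) \<noteq> {} \<longleftrightarrow>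
        \<alpha>1 \<noteq> 0 \<and> \<alpha>2 = 0 \<and> \<beta>1 = 0) \<and>
      (\<forall>\<alpha>1 \<beta>1 \<beta>2. left_quasiunits (A2_2 \<alpha>1 \<beta>1 \<beta>2 :: 'a ^ 4 ^ 2) \<noteq> {} \<longleftrightarrow>
        \<alpha>1 \<noteq> 0 \<and> \<beta>1 = 0) \<and>
      (\<forall>\<alpha>1 \<beta>2. left_quasiunits (A3_2 \<alpha>1 \<beta>2 :: 'a ^ 4 ^ 2) \<noteq> {} \<longleftrightarrow>
        \<alpha>1 = 1 \<or> \<beta>2 = 1) \<and>
      (\<forall>\<alpha>1 \<beta>2. left_quasiunits (A4_2 \<alpha>1 \<beta>2 :: 'a ^ 4 ^ 2) \<noteq> {} \<longleftrightarrow>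
        \<alpha>1 = 1
        \<or> (\<alpha>1 \<noteq> 0 \<and> \<alpha>1 \<noteq> 1 \<and> \<beta>2 \<noteq> 1)
        \<or> (\<alpha>1 \<noteq> 0 \<and> \<alpha>1 \<noteq> 1 \<and> \<beta>2 = 1)) \<and>
      (\<forall>\<alpha>1. left_quasiunits (A5_2 \<alpha>1 :: 'a ^ 4 ^ 2) \<noteq> {} \<longleftrightarrow>
        \<alpha>1 = 1) \<and>
      (\<forall>\<alpha>1 \<beta>1. left_quasiunits (A6_2 \<alpha>1 \<beta>1 :: 'a ^ 4 ^ 2) \<noteq> {} \<longleftrightarrow>
        \<alpha>1 \<noteq> 0 \<and> \<beta>1 = 0) \<and>
      (\<forall>\<alpha>1. left_quasiunits (A7_2 \<alpha>1 :: 'a ^ 4 ^ 2) \<noteq> {} \<longleftrightarrow>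
        \<alpha>1 = 0 \<or> \<alpha>1 = 1) \<and>
      (\<forall>\<alpha>1. left_quasiunits (A8_2 \<alpha>1 :: 'a ^ 4 ^ 2) \<noteq> {} \<longleftrightarrow>
        (\<alpha>1 \<noteq> 0 \<and> \<alpha>1 \<noteq> 1) \<or> \<alpha>1 = 1) \<and>
      (left_quasiunits (A9_2 :: 'a ^ 4 ^ 2) = {}) \<and>
      (left_quasiunits (A10_2 :: 'a ^ 4 ^ 2) \<noteq> {}) \<and>
      (left_quasiunits (A11_2 :: 'a ^ 4 ^ 2) = {}) \<and>
      (left_quasiunits (A12_2 :: 'a ^ 4 ^ 2) = {})) \<and>
     (CHAR('a) = 3 \<longrightarrow>
      (\<forall>\<alpha>1 \<beta>1. \<beta>1 \<noteq> 0 \<longrightarrow>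
        left_quasiunits (A1_3 \<alpha>1 (\<alpha>1 * (1 - \<alpha>1) / \<beta>1 - 1 / 2) (\<alpha>1 * (1 - \<alpha>1) ^ 2 / \<beta>1 ^ 2 - (1 - \<alpha>1) / (2 * \<beta>1)) \<beta>1 :: 'a ^ 4 ^ 2) =
        {((1 - \<alpha>1) / \<beta>1) *s e1 + 2 *s e2}) \<and>
      (\<forall>\<alpha>2. left_quasiunits (A1_3 1 \<alpha>2 (\<alpha>2 * (2 * \<alpha>2 + 1) / 2) 0 :: 'a ^ 4 ^ 2) =
        {(\<alpha>2 - 1) *s e1 + 2 *s e2}) \<and>
      (\<forall>\<alpha>1. \<alpha>1 \<noteq> 0 \<longrightarrow>
        left_quasiunits (A2_3 \<alpha>1 0 \<alpha>1 :: 'a ^ 4 ^ 2) = {(1 / \<alpha>1) *s e1}) \<and>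
      (\<forall>\<alpha>1. \<alpha>1 \<noteq> 0 \<and> \<alpha>1 \<noteq> 1 \<longrightarrow>
        left_quasiunits (A4_3 \<alpha>1 (-1 - \<alpha>1) :: 'a ^ 4 ^ 2) = {(1 / \<alpha>1) *s e1 + t *s e2 | t. True}) \<and>
      (\<forall>\<alpha>1 \<beta>2. \<alpha>1 \<noteq> 0 \<and> \<alpha>1 \<noteq> 1 \<and> \<beta>2 \<noteq> -1 - \<alpha>1 \<longrightarrow>
        left_quasiunits (A4_3 \<alpha>1 \<beta>2 :: 'a ^ 4 ^ 2) = {(1 / \<alpha>1) *s e1}) \<and>
      (\<forall>\<beta>2. left_quasiunits (A4_3 1 \<beta>2 :: 'a ^ 4 ^ 2) = {e1 + t *s e2 | t. True}) \<and>
      (left_quasiunits (A5_3 1 :: 'a ^ 4 ^ 2) = {e1 + t *s e2 | t. True}) \<and>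
      (left_quasiunits (A6_3 (-1) 0 :: 'a ^ 4 ^ 2) = {- e1}) \<and>
      (\<forall>\<alpha>1. \<alpha>1 \<noteq> 0 \<longrightarrow>
        left_quasiunits (A8_3 \<alpha>1 :: 'a ^ 4 ^ 2) = {(1 / \<alpha>1) *s e1}) \<and>
      (left_quasiunits (A10_3 :: 'a ^ 4 ^ 2) = {t *s e1 - e2 | t. True}) \<and>
      (\<forall>\<alpha>1 \<alpha>2 \<alpha>4 \<beta>1. left_quasiunits (A1_3 \<alpha>1 \<alpha>2 \<alpha>4 \<beta>1 :: 'a ^ 4 ^ 2) \<noteq> {} \<longleftrightarrow>
        (\<beta>1 \<noteq> 0 \<and>
        \<alpha>2 = \<alpha>1 * (1 - \<alpha>1) / \<beta>1 - 1 / 2 \<and>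
        \<alpha>4 = \<alpha>1 * (1 - \<alpha>1) ^ 2 / \<beta>1 ^ 2 - (1 - \<alpha>1) / (2 * \<beta>1))
        \<or> (\<alpha>1 = 1 \<and> \<alpha>4 = \<alpha>2 * (2 * \<alpha>2 + 1) / 2 \<and> \<beta>1 = 0)) \<and>
      (\<forall>\<alpha>1 \<beta>1 \<beta>2. left_quasiunits (A2_3 \<alpha>1 \<beta>1 \<beta>2 :: 'a ^ 4 ^ 2) \<noteq> {} \<longleftrightarrow>
        \<beta>1 = 0 \<and> \<beta>2 = \<alpha>1 \<and> \<alpha>1 \<noteq> 0) \<and>
      (\<forall>\<beta>1 \<beta>2. left_quasiunits (A3_3 \<beta>1 \<beta>2 :: 'a ^ 4 ^ 2) = {}) \<and>
      (\<forall>\<alpha>1 \<beta>2. left_quasiunits (A4_3 \<alpha>1 \<beta>2 :: 'a ^ 4 ^ 2) \<noteq> {} \<longleftrightarrow>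
        (\<alpha>1 \<noteq> 0 \<and> \<alpha>1 \<noteq> 1 \<and> \<beta>2 = -1 - \<alpha>1)
        \<or> (\<alpha>1 \<noteq> 0 \<and> \<alpha>1 \<noteq> 1 \<and> \<beta>2 \<noteq> -1 - \<alpha>1) \<or> \<alpha>1 = 1) \<and>
      (\<forall>\<alpha>1. left_quasiunits (A5_3 \<alpha>1 :: 'a ^ 4 ^ 2) \<noteq> {} \<longleftrightarrow>
        \<alpha>1 = 1) \<and>
      (\<forall>\<alpha>1 \<beta>1. left_quasiunits (A6_3 \<alpha>1 \<beta>1 :: 'a ^ 4 ^ 2) \<noteq> {} \<longleftrightarrow>
        \<alpha>1 = -1 \<and> \<beta>1 = 0) \<and>
      (\<forall>\<beta>1. left_quasiunits (A7_3 \<beta>1 :: 'a ^ 4 ^ 2) = {}) \<and>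
      (\<forall>\<alpha>1. left_quasiunits (A8_3 \<alpha>1 :: 'a ^ 4 ^ 2) \<noteq> {} \<longleftrightarrow>
        \<alpha>1 \<noteq> 0) \<and>
      (left_quasiunits (A9_3 :: 'a ^ 4 ^ 2) = {}) \<and>
      (left_quasiunits (A10_3 :: 'a ^ 4 ^ 2) \<noteq> {}) \<and>
      (left_quasiunits (A11_3 :: 'a ^ 4 ^ 2) = {}) \<and>
      (left_quasiunits (A12_3 :: 'a ^ 4 ^ 2) = {}))"
proof (rule conjI, goal_cases)
  case 1
  show ?case
  proof (rule impI, goal_cases)
    case 1
    then have "(2 :: 'a) \<noteq> 0" "(3 :: 'a) \<noteq> 0"
      using prime_eq_zero_iff_CHAR[of 2, where ?'a = 'a] prime_eq_zero_iff_CHAR[of 3, where ?'a = 'a]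
      by simp_all
    note A1 = left_quasiunits_A1[OF this(1)] and this
    then show ?case
    proof (intro conjI, goal_cases)
      case 1
      \<comment> \<open>The hypotheses are literally the first condition of the case distinction, so
        no field arithmetic is needed.\<close>
      show ?case unfolding A1 by (intro allI impI if_P)
    next
      case 2
      show ?case by (simp add: A1)
    next
      case 12
      show ?case by (simp only: A1 split: if_splits) blast
    qed (auto simp: left_quasiunits_families)
  qed
next
  case 2
  show ?case
  proof (rule conjI, goal_cases)
    case 1
    show ?case
    proof (rule impI, goal_cases)
      case 1
      then have "(2 :: 'a) = 0"
        using prime_eq_zero_iff_CHAR[of 2, where ?'a = 'a] by simp
      \<comment> \<open>\<open>3 = 1\<close> turns the exceptional condition
        \<open>a1 * 3 = 1\<close> for \<open>A8\<close> into \<open>a1 = 1\<close>; likewise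
        \<open>- 1 = 1\<close> turns \<open>2 * a1 - 1\<close> for \<open>A4\<close> into
        \<open>1\<close>.\<close>
      moreover from this have "(1 :: 'a) + 2 = 1" by (simp only: add_0_right)
      then have "(3 :: 'a) = 1" by simp
      moreover note minus_one_char_2[OF \<open>2 = 0\<close>]
      ultimately show ?case
        by (intro conjI)
          (auto simp: left_quasiunits_families(2,4-6,8,11-12) left_quasiunits_A1_char_2
            left_quasiunits_A10_char_2 left_quasiunits_A3_2 left_quasiunits_A7_2
            left_quasiunits_A9_2 left_quasiunits_A11_2 families_char_2 A5_2_eq_A5)
    qed
  next
    case 2
    show ?case
    proof (rule impI, goal_cases)
      case 1
      then have "(3 :: 'a) = 0" and "(2 :: 'a) \<noteq> 0"
        using prime_eq_zero_iff_CHAR[of 2, where ?'a = 'a] prime_eq_zero_iff_CHAR[of 3, where ?'a = 'a]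
        by simp_all
      note A1 = left_quasiunits_A1_char_3[OF this] and this
      then show ?case
      proof (intro conjI, goal_cases)
        case 1
        show ?case unfolding families_char_3 A1 by (intro allI impI if_P conjI refl)
      next
        case 2
        show ?case by (simp add: families_char_3 A1)
      next
        case 11
        show ?case unfolding families_char_3 by (simp only: A1 split: if_splits) blast
      \<comment> \<open>With \<open>3 = 0\<close> the exceptional branch for \<open>A8\<close> reads
        \<open>0 = 1\<close>, and the constraint \<open>3 * t = 0\<close> for \<open>A10\<close>
        admits every \<open>t\<close>.\<close>
      qed (auto simp: left_quasiunits_families(2-5,7-12) left_quasiunits_A6_char_3 families_char_3
          A5_3_eq_A5 left_quasiunits_A11_3)
    qed
  qed
qed

end
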